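(* Let $c\ge1$. Then there exist constants $M\ge\sqrt2$ and $M',a>0$ such that, for every integer $n\ge\max(cM,3)$ and every integer $k$ with $|k|\le n/M$, the function $f(x)=e^{ik\pi x}$ satisfies $$|\langle f,\psi_{n,c}\rangle|\le M'e^{-an}.$$
   Context: For $c>0$, the prolate spheroidal wave functions (PSWFs) $(\psi_{n,c})_{n\ge 0}$ form the orthonormal basis of $L^2([-1,1])$ consisting of (real-valued) eigenfunctions of the compact integral operator $\mathcal Q_c(f)(x)=\int_{-1}^1\frac{\sin c(x-y)}{\pi(x-y)}f(y)\,dy$ on $L^2([-1,1])$, ordered so that the corresponding eigenvalues $\lambda_n(c)$ satisfy $1>\lambda_0(c)>\lambda_1(c)>\cdots>0$. Here $\langle f,g\rangle=\int_{-1}^1f(x)\overline{g(x)}\,dx$. *)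

theory Defs
  imports "HOL-Analysis.Analysis"
begin

abbreviation interval_measure :: "real measure" where
  "interval_measure \<equiv> lebesgue_on {-1..1}"

text \<open>Elements of \<open>L\<^sup>2([-1,1])\<close> are represented by functions; equality of classes is equality
  almost everywhere, and values outside \<open>[-1,1]\<close> are irrelevant.\<close>

definition L2 :: "(real \<Rightarrow> complex) set" where
  "L2 = {f. f \<in> borel_measurable interval_measure \<and>
            integrable interval_measure (\<lambda>x. (cmod (f x))\<^sup>2)}"

definition L2_inner :: "(real \<Rightarrow> complex) \<Rightarrow> (real \<Rightarrow> complex) \<Rightarrow> complex" where
  "L2_inner f g = (LINT x|interval_measure. f x * cnj (g x))"

definition L2_norm :: "(real \<Rightarrow> complex) \<Rightarrow> real" where
  "L2_norm f = sqrt (LINT x|interval_measure. (cmod (f x))\<^sup>2)"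

definition L2_orthonormal_basis :: "(nat \<Rightarrow> real \<Rightarrow> complex) \<Rightarrow> bool" where
  "L2_orthonormal_basis e \<longleftrightarrow>
     (\<forall>n. e n \<in> L2) \<and>
     (\<forall>m n. L2_inner (e m) (e n) = (if m = n then 1 else 0)) \<and>
     (\<forall>f\<in>L2. (\<lambda>N. L2_norm (\<lambda>x. f x - (\<Sum>n<N. L2_inner f (e n) * e n x))) \<longlonglongrightarrow> 0)"

text \<open>On the diagonal the kernel below has the value \<open>0\<close> (division by zero) instead of its
  limit \<open>c / pi\<close>; for each \<open>x\<close> this concerns the single point \<open>y = x\<close> and does not affect the
  integral.\<close>

definition sinc_operator :: "real \<Rightarrow> (real \<Rightarrow> complex) \<Rightarrow> real \<Rightarrow> complex" where
  "sinc_operator c f x =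
     (LINT y|interval_measure. complex_of_real (sin (c * (x - y)) / (pi * (x - y))) * f y)"

text \<open>The eigenvalues are simple, so this determines every \<open>\<psi> n\<close> up to sign and up to
  equality almost everywhere on \<open>[-1,1]\<close>.\<close>

definition is_PSWF :: "real \<Rightarrow> (nat \<Rightarrow> real \<Rightarrow> real) \<Rightarrow> bool" where
  "is_PSWF c \<psi> \<longleftrightarrow>
     L2_orthonormal_basis (\<lambda>n x. complex_of_real (\<psi> n x)) \<and>
     (\<exists>ev :: nat \<Rightarrow> real.
        ev 0 < 1 \<and> (\<forall>n. ev (Suc n) < ev n) \<and> (\<forall>n. 0 < ev n) \<and>
        (\<forall>n. AE x in interval_measure.
           sinc_operator c (\<lambda>y. complex_of_real (\<psi> n y)) x
             = complex_of_real (ev n) * complex_of_real (\<psi> n x)))"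

end

theory Submission
  imports Defs "HOL-Probability.Characteristic_Functions"
begin

text \<open>
  Let \<open>\<Psi> w = \<integral> cis (w x) \<psi>\<^sub>n x dx\<close> over \<open>[-1,1]\<close>. Writing the sinc kernel as an integral of cosines shows
  that \<open>\<integral> \<bar>\<Psi>\<bar>\<^sup>2 = \<pi> \<lambda>\<^sub>n\<close> over \<open>[0,c]\<close>. A min-max argument with a combination of \<open>\<psi>\<^sub>0, \<dots>, \<psi>\<^sub>n\<close>
  orthogonal to all polynomials of degree less than \<open>n\<close> gives \<open>\<lambda>\<^sub>n \<le> C (c\<^sup>n / n!)\<^sup>2\<close>, and as \<open>\<Psi>\<close> is
  Lipschitz, this makes \<open>\<Psi>\<close> pointwise superexponentially small on \<open>[0,c]\<close>. Newton's forward difference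
  formula with \<open>N \<approx> n / 8\<close> equidistant nodes in \<open>[0,c]\<close> extrapolates this to \<open>w = k \<pi>\<close> with
  \<open>\<bar>k\<bar> \<le> n / 200\<close>: the coefficients grow at most like \<open>n\<^bsup>2N\<^esup>\<close>, which \<open>\<Psi>\<close> on \<open>[0,c]\<close> absorbs, and the
  remainder is exponentially small in \<open>n\<close>.
\<close>

section \<open>Fourier transforms of functions on the interval\<close>

text \<open>At \<open>w = k * pi\<close> this is the inner product of the theorem. Since
  \<open>u\<close> is real, the modulus is even in \<open>w\<close>, so nonnegative frequencies
  suffice.\<close>

definition fourier :: "(real \<Rightarrow> real) \<Rightarrow> real \<Rightarrow> complex" where
  "fourier u w = (LINT x|interval_measure. cis (w * x) * complex_of_real (u x))"

section \<open>Measurability, integrability and Fubini on compact intervals\<close>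

lemma borel_measurable_cis [measurable]: "cis \<in> borel_measurable borel"
  by (intro borel_measurable_continuous_onI continuous_intros)

lemma measurable_id_lebesgue_on [measurable]:
  "(\<lambda>x. x) \<in> borel_measurable (lebesgue_on (S :: real set))"
  by (rule measurable_restrict_space1) (simp add: borel_measurable_if_I measurable_completion)

lemma finite_measure_lebesgue_interval: "finite_measure (lebesgue_on {a..b::real})"
  by (rule finite_measure_lebesgue_on) simp

lemma integral_const_lebesgue_interval:
  "a \<le> b \<Longrightarrow> (LINT x|lebesgue_on {a..b::real}. (k::real)) = k * (b - a)"
  by (simp add: measure_restrict_space)

lemma integrable_bounded_mult:
  fixes g :: "'a \<Rightarrow> 'b::{real_normed_field, banach, second_countable_topology}"
  assumes "integrable M u" "g \<in> borel_measurable M" "\<And>x. x \<in> space M \<Longrightarrow> norm (g x) \<le> B"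
  shows "integrable M (\<lambda>x. g x * u x)"
proof (rule Bochner_Integration.integrable_bound)
  show "integrable M (\<lambda>x. B * norm (u x))"
    using assms(1) by simp
  show "(\<lambda>x. g x * u x) \<in> borel_measurable M"
    using assms by measurable
  show "AE x in M. norm (g x * u x) \<le> norm (B * norm (u x))"
    using assms(3) by (intro AE_I2) (auto simp: norm_mult intro!: mult_right_mono order_trans[OF _ abs_ge_self])
qed

lemma norm_integral_bounded_mult:
  fixes g :: "'a \<Rightarrow> 'b::{real_normed_field, banach, second_countable_topology}"
  assumes "integrable M u" "g \<in> borel_measurable M" "\<And>x. x \<in> space M \<Longrightarrow> norm (g x) \<le> B"
  shows "norm (LINT x|M. g x * u x) \<le> B * (LINT x|M. norm (u x))"
proof -
  have "norm (LINT x|M. g x * u x) \<le> (LINT x|M. norm (g x * u x))"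
    by (rule integral_norm_bound)
  also have "\<dots> \<le> (LINT x|M. B * norm (u x))"
  proof (rule integral_mono)
    show "integrable M (\<lambda>x. norm (g x * u x))"
      by (intro integrable_norm integrable_bounded_mult[OF assms])
  qed (use assms in \<open>auto simp: norm_mult intro!: mult_right_mono\<close>)
  finally show ?thesis by simp
qed

text \<open>A bounded kernel on a product of finite measures times an integrable function of one
  variable is integrable on the product. This covers both exchanges of integrals in the quadratic
  form below.\<close>

lemma Fubini_bounded_kernel:
  fixes g :: "'a \<Rightarrow> 'b \<Rightarrow> real"
  assumes A: "finite_measure A" and B: "finite_measure B"
    and g[measurable]: "case_prod g \<in> borel_measurable (A \<Otimes>\<^sub>M B)"
    and le: "\<And>a b. a \<in> space A \<Longrightarrow> b \<in> space B \<Longrightarrow> \<bar>g a b\<bar> \<le> K"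
    and u: "integrable B u"
  shows "(LINT b|B. (LINT a|A. g a b) * u b) = (LINT a|A. (LINT b|B. g a b * u b))"
proof -
  interpret A: finite_measure A by fact
  interpret B: finite_measure B by fact
  interpret pair_sigma_finite A B ..
  have [measurable]: "u \<in> borel_measurable B" using u by simp
  have "integrable (A \<Otimes>\<^sub>M B) (\<lambda>p. u (snd p))"
    by (rule Fubini_integrable) (use u in simp_all)
  then have "integrable (A \<Otimes>\<^sub>M B) (\<lambda>p. case_prod g p * u (snd p))"
    by (rule integrable_bounded_mult) (use le g in \<open>auto simp: space_pair_measure\<close>)
  then have "integrable (A \<Otimes>\<^sub>M B) (case_prod (\<lambda>a b. g a b * u b))"
    by (simp add: case_prod_beta')
  from Fubini_integral[OF this] show ?thesis by simp
qed

section \<open>Size and regularity of the transform\<close>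

lemma integrable_fourier:
  assumes "integrable interval_measure u"
  shows "integrable interval_measure (\<lambda>x. cis (w * x) * complex_of_real (u x))"
  by (rule integrable_bounded_mult[where B = 1]) (use assms in auto)

lemma Re_fourier:
  assumes "integrable interval_measure u"
  shows "Re (fourier u w) = (LINT x|interval_measure. cos (w * x) * u x)"
  unfolding fourier_def using integral_Re[OF integrable_fourier[OF assms]] by simp

lemma Im_fourier:
  assumes "integrable interval_measure u"
  shows "Im (fourier u w) = (LINT x|interval_measure. sin (w * x) * u x)"
  unfolding fourier_def using integral_Im[OF integrable_fourier[OF assms]] by simp

lemma norm_fourier_le:
  assumes "integrable interval_measure u"
  shows "cmod (fourier u w) \<le> (LINT x|interval_measure. \<bar>u x\<bar>)"
  unfolding fourier_def
  using norm_integral_bounded_mult[of interval_measure "\<lambda>x. complex_of_real (u x)" "\<lambda>x. cis (w * x)" 1] assms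
  by simp

lemma norm_cis_diff_le: "cmod (cis a - cis b) \<le> \<bar>a - b\<bar>"
proof -
  have "cmod (cis (a - b) - 1) \<le> \<bar>a - b\<bar>"
    using iexp_approx1[of "a - b" 0] by (simp add: cis_conv_exp)
  moreover have "cis a - cis b = cis b * (cis (a - b) - 1)"
    by (simp add: right_diff_distrib cis_mult)
  ultimately show ?thesis by (simp add: norm_mult)
qed

text \<open>\<open>cis\<close> is 1-Lipschitz and \<open>\<bar>x\<bar> \<le> 1\<close> on the
  interval, so the L1 norm of \<open>u\<close> serves as Lipschitz constant.\<close>

lemma fourier_Lipschitz:
  assumes "integrable interval_measure u"
  shows "cmod (fourier u v - fourier u w) \<le> \<bar>v - w\<bar> * (LINT x|interval_measure. \<bar>u x\<bar>)"
proof -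
  have "fourier u v - fourier u w =
      (LINT x|interval_measure. (cis (v * x) - cis (w * x)) * complex_of_real (u x))"
    unfolding fourier_def
    by (subst Bochner_Integration.integral_diff[symmetric])
       (use assms in \<open>auto intro!: integrable_fourier simp: left_diff_distrib\<close>)
  moreover have "cmod (cis (v * x) - cis (w * x)) \<le> \<bar>v - w\<bar>" if "x \<in> {-1..1}" for x
  proof -
    have "\<bar>v * x - w * x\<bar> = \<bar>v - w\<bar> * \<bar>x\<bar>"
      by (metis abs_mult left_diff_distrib)
    also have "\<dots> \<le> \<bar>v - w\<bar> * 1"
      using that by (intro mult_left_mono) auto
    finally show ?thesis using norm_cis_diff_le[of "v * x" "w * x"] by simp
  qed
  ultimately show ?thesis
    using norm_integral_bounded_mult[of interval_measure "\<lambda>x. complex_of_real (u x)"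
        "\<lambda>x. cis (v * x) - cis (w * x)" "\<bar>v - w\<bar>"] assms
    by simp
qed

lemma continuous_on_fourier:
  assumes "integrable interval_measure u"
  shows "continuous_on S (fourier u)"
proof -
  have "(LINT x|interval_measure. \<bar>u x\<bar>)-lipschitz_on UNIV (fourier u)"
    using fourier_Lipschitz[OF assms] by (intro lipschitz_onI) (auto simp: dist_norm mult.commute)
  then show ?thesis
    using lipschitz_on_continuous_on continuous_on_subset by blast
qed

lemma borel_measurable_fourier:
  assumes "integrable interval_measure u"
  shows "fourier u \<in> borel_measurable borel"
  using continuous_on_fourier[OF assms] by (rule borel_measurable_continuous_onI)

section \<open>The sinc operator as a band-limited Plancherel form\<close>

lemma sinc_kernel_eq_integral:
  assumes "c \<ge> 0" "t \<noteq> 0"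
  shows "sin (c * t) / (pi * t) = (LINT w|lebesgue_on {0..c}. cos (w * t)) / pi"
proof -
  have "((\<lambda>w. cos (w * t)) has_integral (sin (c * t) / t - sin (0 * t) / t)) {0..c}"
    by (rule fundamental_theorem_of_calculus)
       (use assms in \<open>auto intro!: derivative_eq_intros simp: has_real_derivative_iff_has_vector_derivative[symmetric]\<close>)
  then have "integral {0..c} (\<lambda>w. cos (w * t)) = sin (c * t) / t"
    by (simp add: integral_unique)
  moreover have "integrable (lebesgue_on {0..c}) (\<lambda>w. cos (w * t))"
    by (intro continuous_imp_integrable_real continuous_intros)
  ultimately show ?thesis
    using lebesgue_integral_eq_integral[of "{0..c}" "\<lambda>w. cos (w * t)"] assms by simp
qed

text \<open>The addition formula splits \<open>cos (w * (x - y))\<close> into products of functions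
  of \<open>x\<close> and of \<open>y\<close>. Integrating against \<open>u y\<close> produces the
  real and imaginary parts of the transform, and integrating against \<open>u x\<close> squares
  them.\<close>

proposition sinc_quadratic_form:
  assumes u: "integrable interval_measure u" and c: "c \<ge> 0"
  shows "(LINT x|interval_measure.
            (LINT y|interval_measure. sin (c * (x - y)) / (pi * (x - y)) * u y) * u x) =
         (LINT w|lebesgue_on {0..c}. (cmod (fourier u w))\<^sup>2) / pi"
proof -
  let ?W = "lebesgue_on {0..c}" and ?I = interval_measure
  note [measurable] = borel_measurable_fourier[OF u]
  \<comment> \<open>\<open>?g w x\<close> is the integral of \<open>cos (w * (x - y)) * u y\<close>
    over \<open>y\<close>.\<close>
  let ?g = "\<lambda>w x. cos (w * x) * Re (fourier u w) + sin (w * x) * Im (fourier u w)"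
  define L where "L = (LINT x|?I. \<bar>u x\<bar>)"
  have int: "integrable ?I (\<lambda>y. cos (w * y) * u y)" "integrable ?I (\<lambda>y. sin (w * y) * u y)" for w
    by (rule integrable_bounded_mult[where B = 1]; use u in simp)+
  have 1: "(LINT y|?I. sin (c * (x - y)) / (pi * (x - y)) * u y) = (LINT w|?W. ?g w x) / pi" for x
  proof -
    have "(LINT y|?I. sin (c * (x - y)) / (pi * (x - y)) * u y) =
        (LINT y|?I. (LINT w|?W. cos (w * (x - y))) * u y / pi)"
    proof (rule integral_cong_AE)
      \<comment> \<open>On the diagonal the sine quotient is \<open>0\<close> by division by zero,
        whereas the cosine integral is \<open>c\<close>; a single point is null.\<close>
      have "AE y in lebesgue. y \<noteq> x"
        by (rule AE_I[of _ _ "{x}"]) auto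
      then have "AE y in ?I. y \<noteq> x"
        by (auto simp: AE_restrict_space_iff)
      then show "AE y in ?I. sin (c * (x - y)) / (pi * (x - y)) * u y =
          (LINT w|?W. cos (w * (x - y))) * u y / pi"
        by eventually_elim (use sinc_kernel_eq_integral[OF c] in simp)
    next
      show "(\<lambda>y. sin (c * (x - y)) / (pi * (x - y)) * u y) \<in> borel_measurable ?I"
        using u by measurable
    next
      interpret finite_measure ?W by (rule finite_measure_lebesgue_interval)
      show "(\<lambda>y. (LINT w|?W. cos (w * (x - y))) * u y / pi) \<in> borel_measurable ?I"
        using u by measurable
    qed
    also have "\<dots> = (LINT w|?W. (LINT y|?I. cos (w * (x - y)) * u y)) / pi"
      by (subst integral_divide_zero, subst Fubini_bounded_kernel[where K = 1])
         (auto simp: finite_measure_lebesgue_interval u)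
    also have "(\<lambda>w. LINT y|?I. cos (w * (x - y)) * u y) = (\<lambda>w. ?g w x)"
    proof
      fix w
      have "(LINT y|?I. cos (w * (x - y)) * u y) =
          (LINT y|?I. cos (w * x) * (cos (w * y) * u y) + sin (w * x) * (sin (w * y) * u y))"
        by (intro Bochner_Integration.integral_cong)
           (simp_all add: right_diff_distrib cos_diff algebra_simps)
      also have "\<dots> = ?g w x"
        using int[of w] by (simp add: Re_fourier[OF u] Im_fourier[OF u])
      finally show "(LINT y|?I. cos (w * (x - y)) * u y) = ?g w x" .
    qed
    finally show ?thesis .
  qed
  have "(LINT x|?I. (LINT y|?I. sin (c * (x - y)) / (pi * (x - y)) * u y) * u x) =
      (LINT x|?I. (LINT w|?W. ?g w x) * u x) / pi"
    unfolding 1 by simp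
  also have "(LINT x|?I. (LINT w|?W. ?g w x) * u x) = (LINT w|?W. (LINT x|?I. ?g w x * u x))"
  proof (rule Fubini_bounded_kernel[where K = "L + L"])
    fix w x
    have "\<bar>cos (w * x) * Re (fourier u w)\<bar> \<le> 1 * L" "\<bar>sin (w * x) * Im (fourier u w)\<bar> \<le> 1 * L"
      unfolding abs_mult L_def
      by (intro mult_mono order_trans[OF abs_Re_le_cmod] order_trans[OF abs_Im_le_cmod]
          norm_fourier_le u; simp)+
    then show "\<bar>?g w x\<bar> \<le> L + L" by linarith
  qed (auto simp: finite_measure_lebesgue_interval u)
  also have "(\<lambda>w. LINT x|?I. ?g w x * u x) = (\<lambda>w. (cmod (fourier u w))\<^sup>2)"
  proof
    fix w
    have "(LINT x|?I. ?g w x * u x) =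
        (LINT x|?I. Re (fourier u w) * (cos (w * x) * u x) + Im (fourier u w) * (sin (w * x) * u x))"
      by (intro Bochner_Integration.integral_cong) (simp_all add: algebra_simps)
    also have "\<dots> = (cmod (fourier u w))\<^sup>2"
      using int[of w] by (simp add: Re_fourier[OF u, symmetric] Im_fourier[OF u, symmetric]
          cmod_power2 flip: power2_eq_square)
    finally show "(LINT x|?I. ?g w x * u x) = (cmod (fourier u w))\<^sup>2" .
  qed
  finally show ?thesis .
qed

section \<open>Pointwise bounds and extrapolation\<close>

text \<open>Gaussian elimination, by induction on the number of equations: either the last equation
  has only zero coefficients, or it eliminates one unknown \<open>p\<close>. The induction varies
  both the index set and the matrix.\<close>

lemma underdetermined_system_has_nontrivial_solution:
  fixes m :: "'i \<Rightarrow> nat \<Rightarrow> 'a::field"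
  assumes "finite I" "n < card I"
  shows "\<exists>a. (\<exists>i\<in>I. a i \<noteq> 0) \<and> (\<forall>j<n. (\<Sum>i\<in>I. a i * m i j) = 0)"
  using assms
proof (induction n arbitrary: I m)
  case 0
  then have "I \<noteq> {}" by auto
  then show ?case by (intro exI[of _ "\<lambda>_. 1"]) auto
next
  case (Suc n)
  show ?case
  proof (cases "\<forall>i\<in>I. m i n = 0")
    case True
    from Suc.IH[of I m] Suc.prems obtain a
      where "\<exists>i\<in>I. a i \<noteq> 0" "\<forall>j<n. (\<Sum>i\<in>I. a i * m i j) = 0" by auto
    with True show ?thesis by (intro exI[of _ a]) (auto simp: less_Suc_eq)
  next
    case False
    then obtain p where p: "p \<in> I" "m p n \<noteq> 0" by auto
    let ?m = "\<lambda>i j. m i j - m i n / m p n * m p j"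
    have "n < card (I - {p})" using Suc.prems p by simp
    with Suc.IH[of "I - {p}" ?m] Suc.prems obtain a
      where a: "\<exists>i\<in>I - {p}. a i \<noteq> 0" "\<And>j. j < n \<Longrightarrow> (\<Sum>i\<in>I - {p}. a i * ?m i j) = 0" by auto
    \<comment> \<open>The value at \<open>p\<close> is forced by equation \<open>n\<close>.
      Substituting it into equation \<open>j\<close> leaves the reduced coefficients
      \<open>?m i j\<close>, and these vanish for \<open>j = n\<close>.\<close>
    define b where "b = a(p := - (\<Sum>i\<in>I - {p}. a i * m i n / m p n))"
    have "(\<Sum>i\<in>I. b i * m i j) = (\<Sum>i\<in>I - {p}. a i * ?m i j)" for j
    proof -
      have "(\<Sum>i\<in>I. b i * m i j) = b p * m p j + (\<Sum>i\<in>I - {p}. b i * m i j)"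
        using p Suc.prems by (simp add: sum.remove)
      also have "(\<Sum>i\<in>I - {p}. b i * m i j) = (\<Sum>i\<in>I - {p}. a i * m i j)"
        by (intro sum.cong) (auto simp: b_def)
      also have "b p * m p j = - (\<Sum>i\<in>I - {p}. a i * (m i n / m p n * m p j))"
        by (simp add: b_def sum_distrib_right mult.assoc)
      finally show ?thesis
        by (simp add: right_diff_distrib sum_subtractf)
    qed
    moreover have "(\<Sum>i\<in>I - {p}. a i * ?m i n) = 0" using p by simp
    ultimately have "\<forall>j<Suc n. (\<Sum>i\<in>I. b i * m i j) = 0"
      using a(2) by (auto simp: less_Suc_eq)
    moreover have "\<exists>i\<in>I. b i \<noteq> 0" using a(1) by (auto simp: b_def)
    ultimately show ?thesis by blast
  qed
qed

text \<open>Rescaling a nontrivial solution by its Euclidean norm. It will yield a unit combination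
  of \<open>n + 1\<close> eigenfunctions whose first \<open>n\<close> moments vanish.\<close>

lemma normalized_solution:
  fixes m :: "nat \<Rightarrow> nat \<Rightarrow> real"
  obtains a where "(\<Sum>i\<le>n. (a i)\<^sup>2) = 1" "\<And>j. j < n \<Longrightarrow> (\<Sum>i\<le>n. a i * m i j) = 0"
proof -
  have "n < card {..n}" by simp
  from underdetermined_system_has_nontrivial_solution[OF finite_atMost this, of m]
  obtain b where b: "\<exists>i\<in>{..n}. b i \<noteq> 0" "\<And>j. j < n \<Longrightarrow> (\<Sum>i\<le>n. b i * m i j) = 0"
    by blast
  define r where "r = sqrt (\<Sum>i\<le>n. (b i)\<^sup>2)"
  obtain i where "i \<in> {..n}" "b i \<noteq> 0" using b(1) by blast
  then have pos: "(\<Sum>i\<le>n. (b i)\<^sup>2) > 0"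
    by (intro sum_pos2[of _ i]) auto
  then have "r\<^sup>2 = (\<Sum>i\<le>n. (b i)\<^sup>2)" "r \<noteq> 0" by (auto simp: r_def)
  note r = this
  show thesis
  proof (rule that[of "\<lambda>i. b i / r"])
    have "(\<Sum>i\<le>n. (b i / r)\<^sup>2) = (\<Sum>i\<le>n. (b i)\<^sup>2) / r\<^sup>2"
      by (simp only: power_divide sum_divide_distrib)
    also have "\<dots> = 1" unfolding r(1) using pos by (metis divide_self less_irrefl)
    finally show "(\<Sum>i\<le>n. (b i / r)\<^sup>2) = 1" .
    fix j assume "j < n"
    have "(\<Sum>i\<le>n. b i / r * m i j) = (\<Sum>i\<le>n. b i * m i j) / r"
      by (simp only: times_divide_eq_left sum_divide_distrib)
    then show "(\<Sum>i\<le>n. b i / r * m i j) = 0" by (simp add: b(2)[OF \<open>j < n\<close>])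
  qed
qed

section \<open>From square integrability to L1 bounds\<close>

lemma integrable_mult_of_squares:
  fixes u v :: "'a \<Rightarrow> real"
  assumes [measurable]: "u \<in> borel_measurable M" "v \<in> borel_measurable M"
    and "integrable M (\<lambda>x. (u x)\<^sup>2)" "integrable M (\<lambda>x. (v x)\<^sup>2)"
  shows "integrable M (\<lambda>x. u x * v x)"
proof (rule Bochner_Integration.integrable_bound)
  show "integrable M (\<lambda>x. (u x)\<^sup>2 + (v x)\<^sup>2)" using assms by simp
  have "\<bar>u x * v x\<bar> \<le> (u x)\<^sup>2 + (v x)\<^sup>2" for x
  proof -
    have "2 * \<bar>u x * v x\<bar> \<le> (u x)\<^sup>2 + (v x)\<^sup>2"
      using sum_squares_bound[of "\<bar>u x\<bar>" "\<bar>v x\<bar>"] by (simp add: abs_mult mult.assoc)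
    then show ?thesis using abs_ge_zero[of "u x * v x"] by linarith
  qed
  then show "AE x in M. norm (u x * v x) \<le> norm ((u x)\<^sup>2 + (v x)\<^sup>2)"
    by simp
qed simp

lemma integrable_of_square:
  fixes u :: "real \<Rightarrow> real"
  assumes "u \<in> borel_measurable interval_measure" "integrable interval_measure (\<lambda>x. (u x)\<^sup>2)"
  shows "integrable interval_measure u"
  using integrable_mult_of_squares[of u interval_measure "\<lambda>_. 1"] assms
  by (simp add: finite_measure.integrable_const finite_measure_lebesgue_interval)

text \<open>Integrating \<open>\<bar>u\<bar> \<le> (1 + u\<^sup>2) / 2\<close> over an interval of
  length 2 gives \<open>(2 + 1) / 2\<close>.\<close>

lemma L1_norm_le:
  fixes u :: "real \<Rightarrow> real"
  assumes u: "u \<in> borel_measurable interval_measure" "integrable interval_measure (\<lambda>x. (u x)\<^sup>2)"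
    and 1: "(LINT x|interval_measure. (u x)\<^sup>2) = 1"
  shows "(LINT x|interval_measure. \<bar>u x\<bar>) \<le> 3/2"
proof -
  interpret finite_measure interval_measure by (rule finite_measure_lebesgue_interval)
  have "(LINT x|interval_measure. \<bar>u x\<bar>) \<le> (LINT x|interval_measure. (1 + (u x)\<^sup>2) / 2)"
  proof (rule integral_mono)
    show "\<bar>u x\<bar> \<le> (1 + (u x)\<^sup>2) / 2" for x
      using sum_squares_bound[of "\<bar>u x\<bar>" 1] by simp
  qed (use u integrable_of_square[OF u] in auto)
  also have "\<dots> = 3/2"
    using u 1 integral_const_lebesgue_interval[of "-1" 1 1] by simp
  finally show ?thesis .
qed

section \<open>Pointwise estimates of the transform\<close>

text \<open>The vanishing moments remove the Taylor polynomial of \<open>cis (w * x)\<close> of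
  degree below \<open>n\<close>, so only the Taylor remainder is integrated against
  \<open>u\<close>.\<close>

lemma norm_fourier_le_of_moments:
  assumes u: "integrable interval_measure u"
    and moments: "\<And>j. j < n \<Longrightarrow> (LINT x|interval_measure. x ^ j * u x) = 0" and "n > 0"
  shows "cmod (fourier u w) \<le> \<bar>w\<bar> ^ n / fact n * (LINT x|interval_measure. \<bar>u x\<bar>)"
proof -
  obtain n' where n': "n = Suc n'" using \<open>n > 0\<close> by (cases n) auto
  let ?T = "\<lambda>x. \<Sum>k\<le>n'. (\<i> * complex_of_real (w * x)) ^ k / fact k"
  let ?c = "\<lambda>k. (\<i> * complex_of_real w) ^ k / fact k"
  have int: "integrable interval_measure (\<lambda>x. x ^ k * u x)" for k
    by (rule integrable_bounded_mult[where B = 1]) (use u in \<open>auto simp: power_abs intro: power_le_one\<close>)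
  have T: "?T x * complex_of_real (u x) = (\<Sum>k\<le>n'. ?c k * complex_of_real (x ^ k * u x))" for x
    by (simp add: sum_distrib_left sum_distrib_right power_mult_distrib mult_ac)
  have intT: "integrable interval_measure (\<lambda>x. ?T x * complex_of_real (u x))"
    unfolding T
    by (intro Bochner_Integration.integrable_sum integrable_mult_right integrable_of_real int)
  have "(LINT x|interval_measure. ?T x * complex_of_real (u x)) =
      (\<Sum>k\<le>n'. ?c k * complex_of_real (LINT x|interval_measure. x ^ k * u x))"
    unfolding T using int by (simp del: of_real_mult of_real_power)
  also have "\<dots> = 0" by (intro sum.neutral) (simp add: moments n')
  finally have "fourier u w =
      (LINT x|interval_measure. (cis (w * x) - ?T x) * complex_of_real (u x))"
    unfolding left_diff_distrib fourier_def
    by (subst Bochner_Integration.integral_diff[OF integrable_fourier[OF u] intT]) simp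
  also have "cmod \<dots> \<le>
      \<bar>w\<bar> ^ n / fact n * (LINT x|interval_measure. norm (complex_of_real (u x)))"
  proof (rule norm_integral_bounded_mult)
    fix x assume "x \<in> space interval_measure"
    then have "\<bar>x\<bar> \<le> 1" by auto
    have "cmod (cis (w * x) - ?T x) \<le> \<bar>w * x\<bar> ^ n / fact n"
      using iexp_approx1[of "w * x" n'] by (simp add: n' cis_conv_exp)
    also have "\<dots> \<le> \<bar>w\<bar> ^ n / fact n"
      using \<open>\<bar>x\<bar> \<le> 1\<close>
      by (intro divide_right_mono power_mono) (auto simp: abs_mult intro: mult_left_le)
    finally show "cmod (cis (w * x) - ?T x) \<le> \<bar>w\<bar> ^ n / fact n" .
  qed (use u in auto)
  finally show ?thesis by simp
qed

text \<open>If \<open>\<bar>fourier u w\<bar> = s\<close>, the Lipschitz bound keeps \<open>\<bar>fourier u\<bar>\<close> above \<open>s/2\<close> on an interval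
  of length \<open>s/3\<close> around or next to \<open>w\<close>.\<close>

lemma norm_fourier_cubed_le:
  assumes u: "integrable interval_measure u" "(LINT x|interval_measure. \<bar>u x\<bar>) \<le> 3/2"
    and c: "c \<ge> 1" and w: "0 \<le> w" "w \<le> c"
  shows "cmod (fourier u w) ^ 3 \<le> 12 * (LINT v|lebesgue_on {0..c}. (cmod (fourier u v))\<^sup>2)"
proof -
  define s where "s = cmod (fourier u w)"
  have s: "0 \<le> s" "s \<le> 3/2"
    using norm_fourier_le[OF u(1), of w] u(2) by (auto simp: s_def)
  obtain p where p: "0 \<le> p" "p + s/3 \<le> c" "p \<le> w" "w \<le> p + s/3"
  \<comment> \<open>The interval goes to the right of \<open>w\<close> if it fits below
    \<open>c\<close>, otherwise to the left. In the latter case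
    \<open>w > c - s/3 \<ge> 1/2 \<ge> s/3\<close>, so it stays nonnegative.\<close>
  proof (cases "w + s/3 \<le> c")
    case True then show ?thesis using w s by (intro that[of w]) auto
  next
    case False then show ?thesis using w s c by (intro that[of "w - s/3"]) auto
  qed
  have ge: "s/2 \<le> cmod (fourier u v)" if "v \<in> {p..p + s/3}" for v
  proof -
    have "cmod (fourier u w - fourier u v) \<le> \<bar>w - v\<bar> * (LINT x|interval_measure. \<bar>u x\<bar>)"
      by (rule fourier_Lipschitz[OF u(1)])
    also have "\<dots> \<le> (s/3) * (3/2)"
    proof (intro mult_mono)
      show "\<bar>w - v\<bar> \<le> s/3"
        using that p unfolding abs_le_iff atLeastAtMost_iff by linarith
    qed (use s u(2) in auto)
    finally show ?thesis
      using norm_triangle_ineq2[of "fourier u w" "fourier u v"] by (simp add: s_def)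
  qed
  have "s ^ 3 / 12 = (s/2)\<^sup>2 * (s/3)" by (simp add: power2_eq_square power3_eq_cube)
  also have "\<dots> = (LINT v|lebesgue_on {p..p + s/3}. (s/2)\<^sup>2)"
    using s by (subst integral_const_lebesgue_interval) auto
  also have "\<dots> \<le> (LINT v|lebesgue_on {p..p + s/3}. (cmod (fourier u v))\<^sup>2)"
  proof (rule integral_mono)
    show "integrable (lebesgue_on {p..p + s/3}) (\<lambda>v. (cmod (fourier u v))\<^sup>2)"
      by (intro continuous_imp_integrable_real continuous_intros continuous_on_fourier u)
  qed (use ge s in \<open>auto intro!: power_mono\<close>)
  also have "\<dots> \<le> (LINT v|lebesgue_on {0..c}. (cmod (fourier u v))\<^sup>2)"
  proof -
    let ?f = "\<lambda>v. (cmod (fourier u v))\<^sup>2"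
    have int: "set_integrable lebesgue {a..b} ?f" for a b
      unfolding set_integrable_def
      by (subst integrable_restrict_space[symmetric])
         (auto intro!: continuous_imp_integrable_real continuous_on_power continuous_on_norm continuous_on_fourier u)
    have "set_lebesgue_integral lebesgue {p..p + s/3} ?f \<le> set_lebesgue_integral lebesgue {0..c} ?f"
      unfolding set_lebesgue_integral_def
      by (rule integral_mono)
         (use int p in \<open>auto simp: set_integrable_def indicator_def\<close>)
    then show ?thesis
      by (simp add: integral_restrict_space set_lebesgue_integral_def)
  qed
  finally show ?thesis by (simp add: s_def)
qed

text \<open>A single term of the exponential series is at most its sum. With \<open>x = n\<close>
  this replaces Stirling's formula.\<close>

lemma power_le_fact_exp:
  assumes "x \<ge> (0::real)"
  shows "x ^ n \<le> fact n * exp x"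
proof -
  have "inverse (fact n) * x ^ n = (\<Sum>k\<in>{n}. inverse (fact k) * x ^ k)" by simp
  also have "\<dots> \<le> (\<Sum>k. inverse (fact k) * x ^ k)"
    using assms by (intro sum_le_suminf summable_exp) auto
  also have "\<dots> = exp x" by (simp add: exp_def)
  finally show ?thesis by (simp add: field_simps)
qed

text \<open>Expands \<open>cis (m h x) = (1 + (cis (h x) - 1))\<^sup>m\<close>. The terms with \<open>j < N\<close> are differences of values
  of the transform at nodes in \<open>[0,c]\<close>; for \<open>j \<ge> N\<close> the weight \<open>exp (j - N) \<ge> 1\<close> is inserted, so that
  the whole tail sums up by the binomial theorem.\<close>

lemma norm_fourier_extrapolation:
  assumes u: "integrable interval_measure u"
    and L: "(LINT x|interval_measure. \<bar>u x\<bar>) \<le> L"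
    and \<epsilon>: "\<And>w. 0 \<le> w \<Longrightarrow> w \<le> c \<Longrightarrow> cmod (fourier u w) \<le> \<epsilon>"
    and h: "0 \<le> h" "real N * h \<le> c"
  shows "cmod (fourier u (real m * h)) \<le>
           real N * (2 * (real m + 1)) ^ N * \<epsilon> + L * exp (exp 1 * (real m * h) - real N)"
proof -
  \<comment> \<open>\<open>A j\<close> is the \<open>j\<close>-th forward difference with step
    \<open>h\<close> of the transform at \<open>0\<close>, taken under the integral sign.\<close>
  define A where "A j = (LINT x|interval_measure. (cis (h * x) - 1) ^ j * complex_of_real (u x))" for j
  have cis_le: "cmod (cis (h * x) - 1) \<le> h" if "x \<in> {-1..1}" for x
  proof -
    have "cmod (cis (h * x) - 1) \<le> h * \<bar>x\<bar>"
      using norm_cis_diff_le[of "h * x" 0] h by (simp add: abs_mult)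
    also have "\<dots> \<le> h * 1" using that h by (intro mult_left_mono) auto
    finally show ?thesis by simp
  qed
  have pow_le: "norm ((cis (h * x) - 1) ^ j) \<le> h ^ j" if "x \<in> space interval_measure" for x j
    using that cis_le[of x] by (auto simp: norm_power intro!: power_mono)
  have int: "integrable interval_measure (\<lambda>x. (cis (h * x) - 1) ^ j * complex_of_real (u x))" for j
    by (rule integrable_bounded_mult[where B = "h ^ j"]) (use u pow_le in auto)
  have "0 \<le> L" using L by (rule order_trans[rotated]) simp
  have "0 \<le> c" using h by (meson mult_nonneg_nonneg of_nat_0_le_iff order_trans)
  then have "0 \<le> \<epsilon>" using \<epsilon>[of 0] norm_ge_zero order_trans by blast
  have A_le: "cmod (A j) \<le> h ^ j * L" for j
  proof -
    have "cmod (A j) \<le> h ^ j * (LINT x|interval_measure. norm (complex_of_real (u x)))"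
      unfolding A_def by (rule norm_integral_bounded_mult) (use u pow_le in auto)
    also have "\<dots> \<le> h ^ j * L" using L h by (intro mult_left_mono) auto
    finally show ?thesis .
  qed
  have cis_pow: "cis (h * x) ^ l = cis (real l * h * x)" for l x
    by (metis Complex.DeMoivre mult.assoc)
  \<comment> \<open>For \<open>j < N\<close> the nodes \<open>l * h\<close> with
    \<open>l \<le> j\<close> lie in \<open>[0,c]\<close>, where \<open>\<epsilon>\<close> applies;
    the binomial coefficients add up to \<open>2 ^ j\<close>.\<close>
  have A_le': "cmod (A j) \<le> 2 ^ j * \<epsilon>" if "j < N" for j
  proof -
    have "(cis (h * x) - 1) ^ j * complex_of_real (u x) =
        (\<Sum>l\<le>j. of_nat (j choose l) * (-1) ^ (j - l) * (cis (real l * h * x) * complex_of_real (u x)))" for x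
      using binomial_ring[of "cis (h * x)" "-1" j]
      by (simp add: cis_pow sum_distrib_left sum_distrib_right mult_ac)
    then have "A j = (\<Sum>l\<le>j. of_nat (j choose l) * (-1) ^ (j - l) * fourier u (real l * h))"
      unfolding A_def fourier_def by (simp add: integrable_fourier[OF u])
    also have "cmod \<dots> \<le> (\<Sum>l\<le>j. real (j choose l) * \<epsilon>)"
    proof (rule sum_norm_le)
      fix l assume "l \<in> {..j}"
      then have "real l * h \<le> real N * h" using that h by (intro mult_right_mono) auto
      then have "cmod (fourier u (real l * h)) \<le> \<epsilon>" using h by (intro \<epsilon>) auto
      then show "cmod (of_nat (j choose l) * (-1) ^ (j - l) * fourier u (real l * h)) \<le> real (j choose l) * \<epsilon>"
        by (simp add: norm_mult norm_power mult_left_mono)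
    qed
    also have "\<dots> = 2 ^ j * \<epsilon>"
      by (simp add: sum_distrib_right[symmetric] of_nat_sum[symmetric] choose_row_sum del: of_nat_sum)
    finally show ?thesis .
  qed
  have "cis (real m * h * x) * complex_of_real (u x) =
      (\<Sum>j\<le>m. of_nat (m choose j) * ((cis (h * x) - 1) ^ j * complex_of_real (u x)))" for x
    using binomial_ring[of "cis (h * x) - 1" 1 m]
    by (simp add: cis_pow sum_distrib_left sum_distrib_right mult_ac)
  then have "fourier u (real m * h) = (\<Sum>j\<le>m. of_nat (m choose j) * A j)"
    unfolding fourier_def A_def by (simp add: int)
  also have "cmod \<dots> \<le> (\<Sum>j\<le>m. (if j < N then (2 * (real m + 1)) ^ N * \<epsilon> else 0) +
      L * exp (- real N) * (real (m choose j) * (exp 1 * h) ^ j))"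
  proof (rule sum_norm_le)
    fix j
    have nonneg: "0 \<le> L * exp (- real N) * (real (m choose j) * (exp 1 * h) ^ j)"
      using \<open>0 \<le> L\<close> h by simp
    show "cmod (of_nat (m choose j) * A j) \<le> (if j < N then (2 * (real m + 1)) ^ N * \<epsilon> else 0) +
      L * exp (- real N) * (real (m choose j) * (exp 1 * h) ^ j)"
    proof (cases "j < N")
      case True
      \<comment> \<open>The base \<open>m + 1\<close> instead of \<open>m\<close> is at least 1 even
        for \<open>m = 0\<close>, so the exponent can later be raised from \<open>j\<close> to
        \<open>N\<close>.\<close>
      have "real (m choose j) \<le> (real m + 1) ^ j"
      proof -
        have "(m choose j) * 1 \<le> (m choose j) * fact j" by (intro mult_left_mono) (auto simp: fact_ge_1)
        also have "\<dots> \<le> m ^ j" by (rule binomial_fact_pow)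
        also have "\<dots> \<le> (m + 1) ^ j" by (intro power_mono) auto
        finally have "real (m choose j) \<le> real ((m + 1) ^ j)" by (simp only: of_nat_le_iff mult_1_right)
        then show ?thesis by (simp add: add.commute)
      qed
      then have "cmod (of_nat (m choose j) * A j) \<le> (real m + 1) ^ j * (2 ^ j * \<epsilon>)"
        using A_le'[OF True] by (auto simp: norm_mult intro!: mult_mono)
      also have "\<dots> = (2 * (real m + 1)) ^ j * \<epsilon>" by (simp only: power_mult_distrib mult_ac)
      also have "\<dots> \<le> (2 * (real m + 1)) ^ N * \<epsilon>"
        using True \<open>0 \<le> \<epsilon>\<close> by (intro mult_right_mono power_increasing) auto
      finally show ?thesis using nonneg True by simp
    next
      case False
      have "h ^ j \<le> exp (- real N) * (exp 1 * h) ^ j"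
      proof -
        have "1 * h ^ j \<le> exp (real j - real N) * h ^ j"
          using False h by (intro mult_right_mono) auto
        also have "exp (real j - real N) = exp (- real N) * exp 1 ^ j"
          by (simp add: exp_of_nat_mult[symmetric] exp_add[symmetric] flip: exp_of_nat_mult)
        finally show ?thesis by (simp add: power_mult_distrib mult_ac)
      qed
      then have "h ^ j * L \<le> exp (- real N) * (exp 1 * h) ^ j * L"
        using \<open>0 \<le> L\<close> by (rule mult_right_mono)
      with A_le[of j] have "cmod (A j) \<le> exp (- real N) * (exp 1 * h) ^ j * L" by linarith
      then have "cmod (of_nat (m choose j) * A j) \<le>
          real (m choose j) * (exp (- real N) * (exp 1 * h) ^ j * L)"
        by (simp add: norm_mult mult_left_mono)
      then show ?thesis using False by (simp add: mult_ac)
    qed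
  qed
  also have "\<dots> = (\<Sum>j\<in>{..m} \<inter> {j. j < N}. (2 * (real m + 1)) ^ N * \<epsilon>) +
      L * exp (- real N) * (exp 1 * h + 1) ^ m"
  proof -
    have "(\<Sum>j\<le>m. if j < N then (2 * (real m + 1)) ^ N * \<epsilon> else 0) =
        (\<Sum>j\<in>{..m} \<inter> {j. j < N}. (2 * (real m + 1)) ^ N * \<epsilon>)"
      by (simp only: sum.inter_restrict finite_atMost mem_Collect_eq)
    moreover have "(exp 1 * h + 1) ^ m = (\<Sum>j\<le>m. real (m choose j) * (exp 1 * h) ^ j)"
      by (simp add: binomial_ring)
    ultimately show ?thesis
      by (simp only: sum.distrib sum_distrib_left[symmetric])
  qed
  also have "\<dots> \<le> real N * ((2 * (real m + 1)) ^ N * \<epsilon>) + L * exp (- real N) * exp (exp 1 * h) ^ m"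
  proof (intro add_mono mult_left_mono power_mono)
    have "card ({..m} \<inter> {j. j < N}) \<le> card {..<N}" by (intro card_mono) auto
    then have "real (card ({..m} \<inter> {j. j < N})) \<le> real N" by simp
    then have "real (card ({..m} \<inter> {j. j < N})) * ((2 * (real m + 1)) ^ N * \<epsilon>) \<le>
        real N * ((2 * (real m + 1)) ^ N * \<epsilon>)"
      using \<open>0 \<le> \<epsilon>\<close> by (intro mult_right_mono) auto
    then show "(\<Sum>j\<in>{..m} \<inter> {j. j < N}. (2 * (real m + 1)) ^ N * \<epsilon>) \<le>
        real N * ((2 * (real m + 1)) ^ N * \<epsilon>)" by simp
    show "exp 1 * h + 1 \<le> exp (exp 1 * h)" using exp_ge_add_one_self[of "exp 1 * h"] by (simp only: add.commute)
  qed (use \<open>0 \<le> L\<close> h in auto)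
  also have "L * exp (- real N) * exp (exp 1 * h) ^ m = L * exp (exp 1 * (real m * h) - real N)"
    by (simp add: exp_diff exp_minus field_simps flip: exp_of_nat_mult)
  finally show ?thesis by (simp add: mult.assoc)
qed

section \<open>Eigenfunctions of the sinc operator\<close>

text \<open>Real-valued form of the PSWF conditions, free of the embedding into the complex numbers.
  The eigenvalue sequence, only asserted to exist in \<open>is_PSWF\<close>, becomes a
  parameter.\<close>

locale sinc_eigenfunctions =
  fixes c :: real and \<psi> :: "nat \<Rightarrow> real \<Rightarrow> real" and ev :: "nat \<Rightarrow> real"
  assumes c_ge_1: "c \<ge> 1"
    and measurable_psi [measurable]: "\<And>n. \<psi> n \<in> borel_measurable interval_measure"
    and integrable_psi_square: "\<And>n. integrable interval_measure (\<lambda>x. (\<psi> n x)\<^sup>2)"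
    and psi_orthonormal:
      "\<And>m n. (LINT x|interval_measure. \<psi> m x * \<psi> n x) = (if m = n then 1 else 0)"
    and eigenfunction: "\<And>n. AE x in interval_measure.
      (LINT y|interval_measure. sin (c * (x - y)) / (pi * (x - y)) * \<psi> n y) = ev n * \<psi> n x"
    and ev_decreasing: "\<And>n. ev (Suc n) < ev n"
begin

lemma integrable_psi: "integrable interval_measure (\<psi> n)"
  by (rule integrable_of_square[OF measurable_psi integrable_psi_square])

lemma integrable_psi_mult: "integrable interval_measure (\<lambda>x. \<psi> m x * \<psi> n x)"
  by (rule integrable_mult_of_squares) (auto intro: integrable_psi_square)

lemma L1_norm_psi_le: "(LINT x|interval_measure. \<bar>\<psi> n x\<bar>) \<le> 3/2"
  using psi_orthonormal[of n n]
  by (intro L1_norm_le measurable_psi integrable_psi_square) (simp add: power2_eq_square)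

lemma integral_combination_product:
  "integrable interval_measure (\<lambda>x. (\<Sum>i\<le>n. a i * \<psi> i x) * (\<Sum>i\<le>n. b i * \<psi> i x))"
  "(LINT x|interval_measure. (\<Sum>i\<le>n. a i * \<psi> i x) * (\<Sum>i\<le>n. b i * \<psi> i x)) =
     (\<Sum>i\<le>n. a i * b i)"
proof -
  have *: "(\<Sum>i\<le>n. a i * \<psi> i x) * (\<Sum>i\<le>n. b i * \<psi> i x) =
      (\<Sum>i\<le>n. \<Sum>j\<le>n. a i * b j * (\<psi> i x * \<psi> j x))" for x
    by (simp add: sum_product mult_ac)
  show "integrable interval_measure (\<lambda>x. (\<Sum>i\<le>n. a i * \<psi> i x) * (\<Sum>i\<le>n. b i * \<psi> i x))"
    unfolding * by (intro Bochner_Integration.integrable_sum integrable_mult_right integrable_psi_mult)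
  have "(LINT x|interval_measure. (\<Sum>i\<le>n. a i * \<psi> i x) * (\<Sum>i\<le>n. b i * \<psi> i x)) =
      (\<Sum>i\<le>n. \<Sum>j\<le>n. a i * b j * (if i = j then 1 else 0))"
    unfolding *
    by (subst Bochner_Integration.integral_sum)
       (auto intro!: Bochner_Integration.integrable_sum integrable_psi_mult
         simp: integrable_psi_mult psi_orthonormal)
  also have "\<dots> = (\<Sum>i\<le>n. a i * b i)"
    by (intro sum.cong) (simp_all add: if_distrib[of "\<lambda>t. _ * t"] sum.delta cong: if_cong)
  finally show "(LINT x|interval_measure. (\<Sum>i\<le>n. a i * \<psi> i x) * (\<Sum>i\<le>n. b i * \<psi> i x)) =
     (\<Sum>i\<le>n. a i * b i)" .
qed

text \<open>The eigenvalue equation and orthonormality diagonalize the quadratic form of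
  \<open>sinc_quadratic_form\<close> on the span of \<open>\<psi> 0\<close>, ...,
  \<open>\<psi> n\<close>.\<close>

lemma integral_fourier_combination:
  "(LINT w|lebesgue_on {0..c}. (cmod (fourier (\<lambda>x. \<Sum>i\<le>n. a i * \<psi> i x) w))\<^sup>2) =
     pi * (\<Sum>i\<le>n. ev i * (a i)\<^sup>2)"
proof -
  let ?u = "\<lambda>x. \<Sum>i\<le>n. a i * \<psi> i x"
  let ?K = "\<lambda>x y. sin (c * (x - y)) / (pi * (x - y))"
  have u: "integrable interval_measure ?u"
    by (intro Bochner_Integration.integrable_sum integrable_mult_right integrable_psi)
  have kernel_bounded: "\<bar>?K x y\<bar> \<le> c / pi" for x y
  proof (cases "x = y")
    case False
    have "\<bar>sin (c * (x - y))\<bar> \<le> c * \<bar>x - y\<bar>"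
      using abs_sin_x_le_abs_x[of "c * (x - y)"] c_ge_1 by (simp add: abs_mult)
    then have "\<bar>sin (c * (x - y))\<bar> / (pi * \<bar>x - y\<bar>) \<le> c * \<bar>x - y\<bar> / (pi * \<bar>x - y\<bar>)"
      by (intro divide_right_mono) auto
    also have "\<dots> = c / pi" using False by simp
    finally show ?thesis by (simp only: abs_divide abs_mult abs_of_pos[OF pi_gt_zero])
  qed (use c_ge_1 in simp)
  have int: "integrable interval_measure (\<lambda>y. ?K x y * \<psi> i y)" for x i
    by (rule integrable_bounded_mult[where B = "c / pi"])
       (use kernel_bounded in \<open>auto intro: integrable_psi\<close>)
  \<comment> \<open>Countably many null sets are merged, so that one \<open>x\<close> serves all
    summands.\<close>
  have "AE x in interval_measure. \<forall>i. (LINT y|interval_measure. ?K x y * \<psi> i y) = ev i * \<psi> i x"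
    unfolding AE_all_countable using eigenfunction by blast
  then have "AE x in interval_measure. (LINT y|interval_measure. ?K x y * ?u y) * ?u x =
      (\<Sum>i\<le>n. (ev i * a i) * \<psi> i x) * ?u x"
  proof eventually_elim
    case (elim x)
    have "(LINT y|interval_measure. ?K x y * ?u y) =
        (LINT y|interval_measure. (\<Sum>i\<le>n. a i * (?K x y * \<psi> i y)))"
      by (simp only: sum_distrib_left mult.left_commute)
    also have "\<dots> = (\<Sum>i\<le>n. a i * (LINT y|interval_measure. ?K x y * \<psi> i y))"
      by (subst Bochner_Integration.integral_sum) (intro integrable_mult_right int, simp only: integral_mult_right_zero)
    also have "\<dots> = (\<Sum>i\<le>n. (ev i * a i) * \<psi> i x)"
      using elim by (simp add: mult_ac)
    finally show ?case by simp
  qed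
  then have "(LINT x|interval_measure. (LINT y|interval_measure. ?K x y * ?u y) * ?u x) =
      (LINT x|interval_measure. (\<Sum>i\<le>n. (ev i * a i) * \<psi> i x) * ?u x)"
  proof (rule integral_cong_AE[rotated 2])
    interpret sigma_finite_measure interval_measure
      by (rule finite_measure.axioms(1)[OF finite_measure_lebesgue_interval])
    show "(\<lambda>x. (LINT y|interval_measure. ?K x y * ?u y) * ?u x) \<in> borel_measurable interval_measure"
      by measurable
  qed measurable
  also have "\<dots> = (\<Sum>i\<le>n. ev i * (a i)\<^sup>2)"
    by (subst integral_combination_product(2)) (simp add: power2_eq_square mult_ac)
  finally show ?thesis
    using sinc_quadratic_form[OF u, of c] c_ge_1 by (simp add: field_simps)
qed

lemma integral_fourier_psi: "(LINT w|lebesgue_on {0..c}. (cmod (fourier (\<psi> n) w))\<^sup>2) = pi * ev n"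
proof -
  have "(\<lambda>x. \<Sum>i\<le>n. (if i = n then 1 else 0) * \<psi> i x) = \<psi> n"
    by (simp add: if_distrib[of "\<lambda>t. t * _"] cong: if_cong)
  moreover have "(\<Sum>i\<le>n. ev i * (if i = n then 1 else 0)\<^sup>2) = ev n"
    by (simp add: if_distrib[of "\<lambda>t. t\<^sup>2"] if_distrib[of "\<lambda>t. _ * t"] cong: if_cong)
  ultimately show ?thesis
    using integral_fourier_combination[where n = n and a = "\<lambda>i. if i = n then 1 else 0"] by simp
qed

section \<open>Superexponential decay and extrapolation for eigenfunctions\<close>

text \<open>For a unit combination \<open>u\<close> with vanishing moments below \<open>n\<close>,
  the quadratic form is at least \<open>ev n\<close>, as the eigenvalues decrease. It is also at
  most \<open>c / pi\<close> times the square of the bound \<open>3/2 * c ^ n / fact n\<close> for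
  the transform.\<close>

lemma eigenvalue_upper_bound:
  assumes "n > 0"
  shows "ev n \<le> 9 * c / (4 * pi) * (c ^ n / fact n)\<^sup>2"
proof -
  obtain a where a: "(\<Sum>i\<le>n. (a i)\<^sup>2) = 1"
    and moments: "\<And>j. j < n \<Longrightarrow> (\<Sum>i\<le>n. a i * (LINT x|interval_measure. x ^ j * \<psi> i x)) = 0"
    using normalized_solution[of n "\<lambda>i j. LINT x|interval_measure. x ^ j * \<psi> i x"] by blast
  define u where "u = (\<lambda>x. \<Sum>i\<le>n. a i * \<psi> i x)"
  have int: "integrable interval_measure (\<lambda>x. x ^ j * \<psi> i x)" for i j
    by (rule integrable_bounded_mult[where B = 1])
       (use integrable_psi in \<open>auto simp: power_abs intro: power_le_one\<close>)
  have u: "integrable interval_measure u"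
    unfolding u_def by (intro Bochner_Integration.integrable_sum integrable_mult_right integrable_psi)
  have "(LINT x|interval_measure. \<bar>u x\<bar>) \<le> 3/2"
  proof (rule L1_norm_le)
    show "integrable interval_measure (\<lambda>x. (u x)\<^sup>2)"
      unfolding u_def power2_eq_square by (rule integral_combination_product)
    show "(LINT x|interval_measure. (u x)\<^sup>2) = 1"
      unfolding u_def power2_eq_square integral_combination_product(2)
      using a by (simp add: power2_eq_square)
  qed (use u in simp)
  moreover have "(LINT x|interval_measure. x ^ j * u x) = 0" if "j < n" for j
  proof -
    have "(LINT x|interval_measure. x ^ j * u x) =
        (LINT x|interval_measure. (\<Sum>i\<le>n. a i * (x ^ j * \<psi> i x)))"
      by (simp add: u_def sum_distrib_left mult_ac)
    also have "\<dots> = (\<Sum>i\<le>n. a i * (LINT x|interval_measure. x ^ j * \<psi> i x))"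
      by (subst Bochner_Integration.integral_sum) (intro integrable_mult_right int, simp only: integral_mult_right_zero)
    finally show ?thesis using moments[OF that] by simp
  qed
  ultimately have le: "cmod (fourier u w) \<le> c ^ n / fact n * (3/2)" if "w \<in> {0..c}" for w
    using that assms
    by (intro order_trans[OF norm_fourier_le_of_moments[OF u]] mult_mono)
       (auto intro!: divide_right_mono power_mono)
  have "pi * ev n = pi * (\<Sum>i\<le>n. ev n * (a i)\<^sup>2)"
    using a by (simp flip: sum_distrib_left)
  also have "\<dots> \<le> pi * (\<Sum>i\<le>n. ev i * (a i)\<^sup>2)"
  proof -
    have "ev n \<le> ev i" if "i \<le> n" for i
      using that by (rule lift_Suc_antimono_le[rotated]) (use ev_decreasing less_imp_le in blast)
    then show ?thesis by (intro mult_left_mono sum_mono mult_right_mono) auto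
  qed
  also have "\<dots> = (LINT w|lebesgue_on {0..c}. (cmod (fourier u w))\<^sup>2)"
    unfolding u_def by (rule integral_fourier_combination[symmetric])
  also have "\<dots> \<le> (LINT w|lebesgue_on {0..c}. (c ^ n / fact n * (3/2))\<^sup>2)"
  proof (rule integral_mono)
    show "integrable (lebesgue_on {0..c}) (\<lambda>w. (cmod (fourier u w))\<^sup>2)"
      by (intro continuous_imp_integrable_real continuous_on_power continuous_on_norm continuous_on_fourier u)
  qed (use le in \<open>auto intro!: power_mono\<close>)
  also have "\<dots> = (c ^ n / fact n * (3/2))\<^sup>2 * c"
    using c_ge_1 by (subst integral_const_lebesgue_interval) auto
  finally show ?thesis
    by (simp add: power_mult_distrib field_simps)
qed

lemma norm_fourier_psi_cubed_le:
  assumes "n > 0" "0 \<le> w" "w \<le> c"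
  shows "cmod (fourier (\<psi> n) w) ^ 3 \<le> 27 * c * (c ^ n / fact n)\<^sup>2"
proof -
  have "cmod (fourier (\<psi> n) w) ^ 3 \<le> 12 * (pi * ev n)"
    using norm_fourier_cubed_le[OF integrable_psi L1_norm_psi_le c_ge_1 assms(2,3)]
    by (simp add: integral_fourier_psi)
  also have "\<dots> \<le> 12 * (pi * (9 * c / (4 * pi) * (c ^ n / fact n)\<^sup>2))"
    by (intro mult_left_mono eigenvalue_upper_bound assms) auto
  also have "\<dots> = 27 * c * (c ^ n / fact n)\<^sup>2" by simp
  finally show ?thesis .
qed

text \<open>After cubing, \<open>n ^ (6 * N) \<le> n ^ n \<le> fact n * exp n\<close> cancels one of
  the two factorials in \<open>norm_fourier_psi_cubed_le\<close>. The other factorial absorbs all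
  remaining geometric growth.\<close>

lemma norm_fourier_psi_superexponential:
  assumes n: "n > 0" and w: "0 \<le> w" "w \<le> c" and N: "6 * N \<le> n"
  shows "real n * real n ^ (2 * N) * cmod (fourier (\<psi> n) w)
           \<le> 162 * c * exp (c\<^sup>2 * exp 3) * exp (- real n / 3)"
proof -
  define s where "s = cmod (fourier (\<psi> n) w)"
  define C where "C = 162 * c * exp (c\<^sup>2 * exp 3)"
  have "C \<ge> 1 * 1 * 1"
    unfolding C_def using c_ge_1 by (intro mult_mono) auto
  have "(real n * real n ^ (2 * N) * s) ^ 3 = real n ^ 3 * real n ^ (6 * N) * s ^ 3"
    by (simp add: power_mult_distrib flip: power_mult)
  also have "\<dots> \<le> (fact 3 * exp (real n)) * real n ^ n * (27 * c * (c ^ n / fact n)\<^sup>2)"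
    unfolding s_def
    by (intro mult_mono norm_fourier_psi_cubed_le power_le_fact_exp power_increasing)
       (use n w N in auto)
  also have "\<dots> \<le> (fact 3 * exp (real n)) * (fact n * exp (real n)) * (27 * c * (c ^ n / fact n)\<^sup>2)"
    using c_ge_1 by (intro mult_mono power_le_fact_exp) auto
  \<comment> \<open>Writing \<open>exp (2 * n)\<close> as \<open>exp (3 * n) * exp (- n)\<close>
    creates the decay; the cost is the factor \<open>exp 3\<close> in the base. The constant is
    \<open>fact 3 * 27\<close>.\<close>
  also have "\<dots> = 162 * c * ((c\<^sup>2 * exp 3) ^ n / fact n) * exp (- real n)"
  proof -
    have "(exp 3 :: real) ^ n = exp (real n) * exp (real n) * exp (real n)"
      by (simp flip: exp_of_nat_mult exp_add)
    then show ?thesis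
      by (simp add: power_mult_distrib power_divide exp_minus fact_numeral field_simps
          power2_eq_square[of "fact n"] flip: power_mult)
  qed
  also have "\<dots> \<le> 162 * c * exp (c\<^sup>2 * exp 3) * exp (- real n)"
    using power_le_fact_exp[of "c\<^sup>2 * exp 3" n] c_ge_1
    by (intro mult_right_mono mult_left_mono) (auto simp: field_simps)
  also have "\<dots> = C * exp (- real n)" by (simp add: C_def)
  \<comment> \<open>\<open>C \<ge> 1\<close> allows replacing \<open>C\<close> by its cube, so that
    cube roots can be taken on both sides.\<close>
  also have "\<dots> \<le> C ^ 3 * exp (- real n)"
    using \<open>C \<ge> 1 * 1 * 1\<close> self_le_power[of C 3] by (intro mult_right_mono) auto
  also have "\<dots> = (C * exp (- real n / 3)) ^ 3"
    by (simp add: power_mult_distrib flip: exp_of_nat_mult)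
  finally have "(real n * real n ^ (2 * N) * s) ^ 3 \<le> (C * exp (- real n / 3)) ^ 3" .
  moreover have "0 \<le> real n * real n ^ (2 * N) * s" "0 \<le> C * exp (- real n / 3)"
    using \<open>C \<ge> 1 * 1 * 1\<close> by (simp_all add: s_def)
  ultimately show ?thesis
    unfolding s_def[symmetric] C_def[symmetric] by (metis power_mono_iff zero_less_numeral)
qed

lemma norm_fourier_psi_decay:
  assumes n: "real n \<ge> 200" and k: "real k \<le> real n / 200"
  shows "cmod (fourier (\<psi> n) (real k * pi))
           \<le> (162 * c * exp (c\<^sup>2 * exp 3) + 3/2) * exp (- real n / 20)"
proof -
  \<comment> \<open>The \<open>+ 1\<close> makes \<open>N\<close> positive and at least
    \<open>n / 8\<close>; \<open>6 * N \<le> n\<close> still holds for large \<open>n\<close>. The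
    step \<open>h\<close> turns \<open>k * pi\<close> into the node number
    \<open>m = 4 * k * N\<close> and keeps \<open>N * h = pi / 4 < 1 \<le> c\<close>.\<close>
  define N where "N = n div 8 + 1"
  define m where "m = 4 * k * N"
  define h where "h = pi / (4 * real N)"
  define C where "C = 162 * c * exp (c\<^sup>2 * exp 3)"
  have "C \<ge> 0" unfolding C_def using c_ge_1 by simp
  have N: "real n / 8 \<le> real N" "6 * N \<le> n" "N \<le> n"
    using n unfolding N_def by auto
  have "real N > 0" unfolding N_def by simp
  then have mh: "real m * h = real k * pi" by (simp add: m_def h_def)
  have "pi < 4" using pi_less_4 .
  \<comment> \<open>The maximum over \<open>[0,c]\<close> serves as \<open>\<epsilon>\<close>, so
    the superexponential bound is needed at one point only.\<close>
  obtain w where w: "0 \<le> w" "w \<le> c"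
    and w_max: "\<And>v. 0 \<le> v \<Longrightarrow> v \<le> c \<Longrightarrow> cmod (fourier (\<psi> n) v) \<le> cmod (fourier (\<psi> n) w)"
  proof -
    have "compact {0..c}" "{0..c} \<noteq> {}" using c_ge_1 by auto
    from continuous_attains_sup[OF this, of "\<lambda>v. cmod (fourier (\<psi> n) v)"] show thesis
      using that by (fastforce intro: continuous_on_norm continuous_on_fourier integrable_psi)
  qed
  have "real N * h \<le> c"
    using \<open>real N > 0\<close> \<open>pi < 4\<close> c_ge_1 by (simp add: h_def)
  then have "cmod (fourier (\<psi> n) (real k * pi)) \<le>
      real N * (2 * (real m + 1)) ^ N * cmod (fourier (\<psi> n) w) +
      3/2 * exp (exp 1 * (real k * pi) - real N)"
    unfolding mh[symmetric]
    by (intro norm_fourier_extrapolation[OF integrable_psi L1_norm_psi_le w_max])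
       (auto simp: h_def)
  also have "\<dots> \<le> C * exp (- real n / 20) + 3/2 * exp (- real n / 20)"
  proof (intro add_mono mult_left_mono)
    have "2 * (real m + 1) \<le> (real n)\<^sup>2"
    proof -
      have "real m \<le> 4 * (real n / 200) * (real n / 6)"
        unfolding m_def of_nat_mult of_nat_numeral using k N(2) by (intro mult_mono) auto
      also have "\<dots> = (real n)\<^sup>2 / 300" by (simp add: power2_eq_square)
      finally have "2 * (real m + 1) \<le> (real n)\<^sup>2 / 150 + 2" by simp
      moreover have "200 * 200 \<le> (real n)\<^sup>2"
        unfolding power2_eq_square using n by (intro mult_mono) auto
      ultimately show ?thesis by linarith
    qed
    then have "(2 * (real m + 1)) ^ N \<le> real n ^ (2 * N)"
      unfolding power_mult by (intro power_mono) auto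
    then have "real N * (2 * (real m + 1)) ^ N * cmod (fourier (\<psi> n) w) \<le>
        real n * real n ^ (2 * N) * cmod (fourier (\<psi> n) w)"
      using N by (intro mult_mono) auto
    also have "\<dots> \<le> C * exp (- real n / 3)"
      unfolding C_def using n by (intro norm_fourier_psi_superexponential w N) auto
    also have "\<dots> \<le> C * exp (- real n / 20)"
      using \<open>C \<ge> 0\<close> by (intro mult_left_mono) auto
    finally show "real N * (2 * (real m + 1)) ^ N * cmod (fourier (\<psi> n) w) \<le> C * exp (- real n / 20)" .
    \<comment> \<open>With \<open>exp 1 \<le> 3\<close> and \<open>pi < 4\<close> the exponent is at
      most \<open>(12/200 - 1/8) * n = - 0.065 * n\<close>, below \<open>- n / 20\<close>.\<close>
    have "exp 1 * (real k * pi) \<le> 3 * (real n / 200 * 4)"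
      using k \<open>pi < 4\<close> exp_le by (intro mult_mono) auto
    then show "exp (exp 1 * (real k * pi) - real N) \<le> exp (- real n / 20)"
      using N by simp
  qed simp
  finally show ?thesis by (simp add: C_def distrib_right)
qed

end

section \<open>Transfer to the prolate spheroidal wave functions\<close>

lemma sinc_eigenfunctions_of_PSWF:
  assumes "c \<ge> 1" "is_PSWF c \<psi>"
  obtains ev where "sinc_eigenfunctions c \<psi> ev"
proof -
  obtain ev where basis: "L2_orthonormal_basis (\<lambda>n x. complex_of_real (\<psi> n x))"
    and ev: "\<And>n. ev (Suc n) < ev n"
      "\<And>n. AE x in interval_measure. sinc_operator c (\<lambda>y. complex_of_real (\<psi> n y)) x
         = complex_of_real (ev n) * complex_of_real (\<psi> n x)"
    using assms(2) unfolding is_PSWF_def by blast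
  have "sinc_eigenfunctions c \<psi> ev"
  proof
    fix m n
    have L2: "(\<lambda>x. complex_of_real (\<psi> n x)) \<in> L2"
      using basis by (simp add: L2_orthonormal_basis_def)
    then have [measurable]: "(\<lambda>x. complex_of_real (\<psi> n x)) \<in> borel_measurable interval_measure"
      by (simp add: L2_def)
    have "(\<lambda>x. Re (complex_of_real (\<psi> n x))) \<in> borel_measurable interval_measure"
      by measurable
    then show "\<psi> n \<in> borel_measurable interval_measure" by simp
    show "integrable interval_measure (\<lambda>x. (\<psi> n x)\<^sup>2)"
      using L2 by (simp add: L2_def)
    have "L2_inner (\<lambda>x. complex_of_real (\<psi> m x)) (\<lambda>x. complex_of_real (\<psi> n x)) = (if m = n then 1 else 0)"
      using basis by (simp add: L2_orthonormal_basis_def)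
    moreover have "L2_inner (\<lambda>x. complex_of_real (\<psi> m x)) (\<lambda>x. complex_of_real (\<psi> n x)) =
        complex_of_real (LINT x|interval_measure. \<psi> m x * \<psi> n x)"
      unfolding L2_inner_def by (simp flip: of_real_mult)
    ultimately show "(LINT x|interval_measure. \<psi> m x * \<psi> n x) = (if m = n then 1 else 0)"
      by (auto split: if_splits)
    have "sinc_operator c (\<lambda>y. complex_of_real (\<psi> n y)) x =
        complex_of_real (LINT y|interval_measure. sin (c * (x - y)) / (pi * (x - y)) * \<psi> n y)" for x
      unfolding sinc_operator_def by (simp only: of_real_mult[symmetric] integral_complex_of_real)
    then show "AE x in interval_measure.
        (LINT y|interval_measure. sin (c * (x - y)) / (pi * (x - y)) * \<psi> n y) = ev n * \<psi> n x"
      using ev(2)[of n] by (simp only: of_real_mult[symmetric] of_real_eq_iff)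
  qed (use assms ev in auto)
  then show thesis by (rule that)
qed

text \<open>For real \<open>u\<close>, reflecting the frequency conjugates the transform. This
  reduces integers \<open>k\<close> to \<open>k \<ge> 0\<close>.\<close>

lemma norm_fourier_uminus: "cmod (fourier u (- w)) = cmod (fourier u w)"
proof -
  have "fourier u (- w) = cnj (fourier u w)"
    unfolding fourier_def
    using Bochner_Integration.integral_cnj[of interval_measure "\<lambda>x. cis (w * x) * complex_of_real (u x)"]
    by (simp add: cis_cnj)
  then show ?thesis by simp
qed

theorem lemma4:
  fixes c :: real
  assumes "c \<ge> 1"
  shows "\<exists>M M' a :: real. M \<ge> sqrt 2 \<and> M' > 0 \<and> a > 0 \<and>
    (\<forall>\<psi>. is_PSWF c \<psi> \<longrightarrow>
      (\<forall>(n::nat) (k::int).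
         real n \<ge> max (c * M) 3 \<longrightarrow> real_of_int \<bar>k\<bar> \<le> real n / M \<longrightarrow>
         cmod (L2_inner (\<lambda>x. exp (\<i> * of_int k * complex_of_real pi * complex_of_real x))
                        (\<lambda>x. complex_of_real (\<psi> n x)))
           \<le> M' * exp (- a * real n)))"
proof (intro exI conjI allI impI)
  \<comment> \<open>The witnesses are \<open>M = 200\<close>, \<open>a = 1/20\<close> and an
    \<open>M'\<close> depending only on \<open>c\<close>. As \<open>c \<ge> 1\<close>, the condition
    \<open>n \<ge> c * M\<close> yields the \<open>n \<ge> 200\<close> of
    \<open>norm_fourier_psi_decay\<close>.\<close>
  show "sqrt 2 \<le> (200::real)" by (rule real_le_lsqrt) auto
  show "0 < 162 * c * exp (c\<^sup>2 * exp 3) + 3/2"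
    using assms by (intro add_nonneg_pos) auto
  show "0 < (1/20 :: real)" by simp
  fix \<psi> n and k :: int
  assume \<psi>: "is_PSWF c \<psi>" and n: "max (c * 200) 3 \<le> real n"
    and k: "real_of_int \<bar>k\<bar> \<le> real n / 200"
  obtain ev where "sinc_eigenfunctions c \<psi> ev"
    by (rule sinc_eigenfunctions_of_PSWF[OF assms \<psi>])
  then interpret sinc_eigenfunctions c \<psi> ev .
  have exp_cis: "exp (\<i> * of_int k * complex_of_real pi * complex_of_real x) =
      cis (real_of_int k * pi * x)" for x
    by (simp add: cis_conv_exp mult_ac)
  have "cmod (L2_inner (\<lambda>x. exp (\<i> * of_int k * complex_of_real pi * complex_of_real x))
      (\<lambda>x. complex_of_real (\<psi> n x))) = cmod (fourier (\<psi> n) (real_of_int k * pi))"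
    unfolding L2_inner_def fourier_def exp_cis by simp
  also have "\<dots> = cmod (fourier (\<psi> n) (real (nat \<bar>k\<bar>) * pi))"
    using norm_fourier_uminus[of "\<psi> n" "real_of_int k * pi"] by (cases "k \<ge> 0") auto
  also have "\<dots> \<le> (162 * c * exp (c\<^sup>2 * exp 3) + 3/2) * exp (- real n / 20)"
    by (rule norm_fourier_psi_decay) (use n k assms in auto)
  finally show "cmod (L2_inner (\<lambda>x. exp (\<i> * of_int k * complex_of_real pi * complex_of_real x))
      (\<lambda>x. complex_of_real (\<psi> n x)))
      \<le> (162 * c * exp (c\<^sup>2 * exp 3) + 3/2) * exp (- (1/20) * real n)" by simp
qed

end
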